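(* $(\hat M,\hat F)$ does not admit any nonempty bounded open $\hat F$-strongly convex subset.
   Context: Structure. $\hat M=\mathbb R^2$ with canonical coordinates $(x^1,x^2)$ (superscripts are indices). $F_0$ is the norm on $\mathbb R^2$ whose unit sphere is the regular hexagon with vertices $\pm(0,1)$, $\pm(\sqrt3/2,1/2)$, $\pm(-\sqrt3/2,1/2)$. For $i\in\{0,\dots,11\}$ put $v_i=(\sin(\pi i/6),\cos(\pi i/6))$ (the direction of the hour hand at $i$ o'clock). $[p_1,\dots,p_n]$ denotes the concatenation of the oriented Euclidean segments $[p_1,p_2],\dots,[p_{n-1},p_n]$, and $\ell_E$ is Euclidean length. Fix $\hat\theta\in(\pi/3,\pi/2]$. For $p\in\hat M$, $A(p)$ is the set of $q\ne p$ such that the Euclidean angle between $q-p$ and $(0,1)$ is at most $\hat\theta$. Let $a,b,c,d\in\mathbb R^2$ be such that $b-a,\ c-b,\ d-c,\ a-d$ are positive multiples of $v_8,v_6,v_2,v_{10}$ respectively and $d-b$ is a positive multiple of $(\sin\hat\theta,\cos\hat\theta)$ (such a trapezoid exists and is unique up to Euclidean homothety); put $L_{\hat\theta}=\ell_E([d,a,b,c])/\ell_E([c,d])>1$. Let $f:\hat M\to\mathbb R$ be a continuous positive function such that $f(q)<f(p)$ whenever $q\in A(p)$, and $f(x)\in(1,L_{\hat\theta})$ for all $x\in\hat M$. Put $\hat F(x,y)=f(x)F_0(y)$ for $x\in\hat M$, $y\in T_x\hat M=\mathbb R^2$. For a piecewise smooth $\gamma:[t_0,s_0]\to\hat M$,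 $\ell_{\hat F}(\gamma)=\int_{t_0}^{s_0}\hat F(\gamma(t),\gamma'(t))\,dt$; $d_{\hat F}(p,q)$ is the infimum of $\ell_{\hat F}$ over piecewise smooth paths from $p$ to $q$. "Bounded" is with respect to the metric $d_{\hat F}$; the topology of $(\hat M,d_{\hat F})$ is the usual topology of $\mathbb R^2$. The path $[p,q]_{\min}$. Let $h_i(p)=\{p+sv_i: s\ge0\}$ and $l_i(p)=\{p+sv_i:s\in\mathbb R\}$. For odd $k\in\{1,3,5,7,9,11\}$, $S_k(p)$ is the open sector of angle $\pi/3$ bounded by $h_{k-1}(p)$ and $h_{k+1}(p)$ (with $h_{12}=h_0$). Let $p\neq q$. If $q-p$ is a positive multiple of some $v_i$ with $i$ even, then $[p,q]_{\min}=[p,q]$. Otherwise $q$ lies in a unique $S_k(p)$; let $h_i(p)$ be its upper and $h_j(p)$ its lower boundary half-line, i.e. $(k,i,j)\in\{(1,0,2),(3,2,4),(5,4,6),(7,8,6),(9,10,8),(11,0,10)\}$; let $a$ be the intersection point of $l_i(p)$ and $l_j(q)$; then $[p,q]_{\min}=[p,a,q]$. Finally $[p,p]_{\min}$ is the constant path at $p$. A subset $U\subset\hat M$ is $\hat F$-strongly convex if $[p,q]_{\min}\setminus\{p,q\}\subset U$ whenever $p,q\in\overline U$ (the closure of $U$). *)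

theory Defs
  imports "HOL-Analysis.Analysis"
begin

section \<open>Directions and Euclidean data\<close>

text \<open>Directions are measured clockwise from the vertical axis, as on a clock face.\<close>

definition clock_dir :: "real \<Rightarrow> real^2" where
  "clock_dir \<phi> = vector [sin \<phi>, cos \<phi>]"

definition v :: "nat \<Rightarrow> real^2" where
  "v i = clock_dir (pi * real i / 6)"

definition pos_multiple :: "real^2 \<Rightarrow> real^2 \<Rightarrow> bool" where
  "pos_multiple u w \<longleftrightarrow> (\<exists>s>0. u = s *\<^sub>R w)"

definition euclid_angle :: "real^2 \<Rightarrow> real^2 \<Rightarrow> real" where
  "euclid_angle u w = arccos (inner u w / (norm u * norm w))"

fun polyline_length :: "(real^2) list \<Rightarrow> real" where
  "polyline_length (p # q # ps) = dist p q + polyline_length (q # ps)"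
| "polyline_length _ = 0"

definition up_cone :: "real \<Rightarrow> real^2 \<Rightarrow> (real^2) set" where
  "up_cone \<theta> p = {q. q \<noteq> p \<and> euclid_angle (q - p) (vector [0, 1]) \<le> \<theta>}"

definition is_trapezoid :: "real \<Rightarrow> real^2 \<Rightarrow> real^2 \<Rightarrow> real^2 \<Rightarrow> real^2 \<Rightarrow> bool" where
  "is_trapezoid \<theta> a b c d \<longleftrightarrow>
     pos_multiple (b - a) (v 8) \<and> pos_multiple (c - b) (v 6) \<and>
     pos_multiple (d - c) (v 2) \<and> pos_multiple (a - d) (v 10) \<and>
     pos_multiple (d - b) (clock_dir \<theta>)"

text \<open>On a trapezoid for \<open>\<theta>\<close> this is the constant \<open>L\<close> attached to \<open>\<theta>\<close>; such trapezoids are unique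
  up to homothety, so the value depends on \<open>\<theta>\<close> only.\<close>

definition trapezoid_ratio :: "real^2 \<Rightarrow> real^2 \<Rightarrow> real^2 \<Rightarrow> real^2 \<Rightarrow> real" where
  "trapezoid_ratio a b c d = polyline_length [d, a, b, c] / polyline_length [c, d]"

section \<open>The Finsler metric\<close>

definition hexagon :: "(real^2) set" where
  "hexagon = convex hull
     {vector [0, 1], vector [0, -1],
      vector [sqrt 3 / 2, 1 / 2], vector [- (sqrt 3 / 2), - (1 / 2)],
      vector [- (sqrt 3 / 2), 1 / 2], vector [sqrt 3 / 2, - (1 / 2)]}"

text \<open>The norm with unit ball \<^const>\<open>hexagon\<close>, as its Minkowski functional.\<close>

definition F0 :: "real^2 \<Rightarrow> real" where
  "F0 y = Inf {t. t > 0 \<and> y \<in> (\<lambda>z. t *\<^sub>R z) ` hexagon}"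

definition Fhat :: "(real^2 \<Rightarrow> real) \<Rightarrow> real^2 \<Rightarrow> real^2 \<Rightarrow> real" where
  "Fhat f x y = f x * F0 y"

text \<open>Smoothness on a compact interval, with one-sided derivatives of all orders at the end points.\<close>

definition smooth_on_interval :: "(real \<Rightarrow> real^2) \<Rightarrow> real \<Rightarrow> real \<Rightarrow> bool" where
  "smooth_on_interval \<gamma> r s \<longleftrightarrow>
     (\<exists>D :: nat \<Rightarrow> real \<Rightarrow> real^2. (\<forall>t\<in>{r..s}. D 0 t = \<gamma> t) \<and>
        (\<forall>n. \<forall>t\<in>{r..s}. (D n has_vector_derivative D (Suc n) t) (at t within {r..s})))"

text \<open>The set \<open>B\<close> contains the break points.\<close>

definition piecewise_smooth :: "(real \<Rightarrow> real^2) \<Rightarrow> real \<Rightarrow> real \<Rightarrow> bool" where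
  "piecewise_smooth \<gamma> t0 s0 \<longleftrightarrow> continuous_on {t0..s0} \<gamma> \<and>
     (\<exists>B. finite B \<and>
        (\<forall>r s. t0 \<le> r \<and> r < s \<and> s \<le> s0 \<and> {r<..<s} \<inter> B = {} \<longrightarrow> smooth_on_interval \<gamma> r s))"

text \<open>The derivative is unspecified only at the end points and break points, which form a finite set.\<close>

definition finsler_length :: "(real^2 \<Rightarrow> real) \<Rightarrow> (real \<Rightarrow> real^2) \<Rightarrow> real \<Rightarrow> real \<Rightarrow> real" where
  "finsler_length f \<gamma> t0 s0 = integral {t0..s0} (\<lambda>t. Fhat f (\<gamma> t) (vector_derivative \<gamma> (at t)))"

definition finsler_dist :: "(real^2 \<Rightarrow> real) \<Rightarrow> real^2 \<Rightarrow> real^2 \<Rightarrow> real" where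
  "finsler_dist f p q =
     Inf {finsler_length f \<gamma> t0 s0 | \<gamma> t0 s0.
       t0 \<le> s0 \<and> piecewise_smooth \<gamma> t0 s0 \<and> \<gamma> t0 = p \<and> \<gamma> s0 = q}"

definition finsler_bounded :: "(real^2 \<Rightarrow> real) \<Rightarrow> (real^2) set \<Rightarrow> bool" where
  "finsler_bounded f U \<longleftrightarrow> (\<exists>p C. \<forall>q\<in>U. finsler_dist f p q \<le> C)"

section \<open>Distinguished minimal paths and strong convexity\<close>

definition dir_line :: "nat \<Rightarrow> real^2 \<Rightarrow> (real^2) set" where
  "dir_line i p = {p + s *\<^sub>R v i | s. True}"

text \<open>For odd \<open>k\<close>, the open sector at \<open>p\<close> between the half-lines in directions \<open>v (k - 1)\<close> and
  \<open>v (k + 1)\<close>; note that \<open>v 12 = v 0\<close>.\<close>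

definition sector :: "nat \<Rightarrow> real^2 \<Rightarrow> (real^2) set" where
  "sector k p = {p + s *\<^sub>R v (k - 1) + t *\<^sub>R v (k + 1) | s t. s > 0 \<and> t > 0}"

text \<open>Triples \<open>(k, i, j)\<close>: directions \<open>i\<close> and \<open>j\<close> are the upper and lower boundary of sector \<open>k\<close>.\<close>

definition sector_table :: "(nat \<times> nat \<times> nat) set" where
  "sector_table = {(1,0,2), (3,2,4), (5,4,6), (7,8,6), (9,10,8), (11,0,10)}"

definition corner :: "real^2 \<Rightarrow> real^2 \<Rightarrow> real^2" where
  "corner p q = (THE a. \<exists>(k, i, j) \<in> sector_table.
     q \<in> sector k p \<and> a \<in> dir_line i p \<inter> dir_line j q)"

definition min_path :: "real^2 \<Rightarrow> real^2 \<Rightarrow> real \<Rightarrow> real^2" where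
  "min_path p q =
     (if p = q then linepath p p
      else if \<exists>i\<in>{0, 2, 4, 6, 8, 10}. pos_multiple (q - p) (v i) then linepath p q
      else linepath p (corner p q) +++ linepath (corner p q) q)"

text \<open>The metric enters only through the choice of the paths \<^const>\<open>min_path\<close>, hence there is no
  parameter for it.\<close>

definition strongly_convex :: "(real^2) set \<Rightarrow> bool" where
  "strongly_convex U \<longleftrightarrow>
     (\<forall>p\<in>closure U. \<forall>q\<in>closure U. path_image (min_path p q) - {p, q} \<subseteq> U)"

end

theory Submission
  imports Defs
begin

text \<open>Write \<open>n\<^sub>i = v (i + 9)\<close> for the normal of \<open>v i\<close>. Let \<open>U\<close> be bounded, open and strongly convex,
  with closure \<open>K\<close>, and for \<open>i \<in> {0, 2, 4}\<close> let \<open>p\<close> and \<open>q\<close> maximise \<open>n\<^sub>i\<close> and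
  \<open>n\<^bsub>i+2\<^esub>\<close> on \<open>K\<close>. If \<open>p \<noteq> q\<close>, then \<open>q - p\<close> lies in the closed sector spanned by \<open>v i\<close> and
  \<open>v (i + 2)\<close>, so the minimal path from \<open>p\<close> to \<open>q\<close> has an inner point on the support line of \<open>K\<close>
  at \<open>p\<close> or at \<open>q\<close>; but inner points belong to the open set \<open>U\<close>. Hence \<open>p = q\<close>, and a single point
  maximises \<open>n\<^sub>0\<close> and \<open>n\<^sub>6 = - n\<^sub>0\<close> on \<open>K\<close>, which is impossible. Boundedness in the Finsler metric
  implies Euclidean boundedness because \<open>f > 1\<close> and the hexagon lies in the Euclidean unit ball.\<close>

section \<open>The hexagonal norm\<close>

lemma norm_vec2: "norm (y :: real^2) = sqrt ((y$1)\<^sup>2 + (y$2)\<^sup>2)"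
  by (simp add: norm_vec_def L2_set_def sum_2)

lemma convex_hexagon: "convex hexagon"
  by (simp add: hexagon_def)

lemma norm_hexagon_le: 
  assumes "z \<in> hexagon"
  shows "norm z \<le> 1"
proof -
  have "hexagon \<subseteq> cball 0 1"
    unfolding hexagon_def by (rule hull_minimal) (auto simp: norm_vec2 power_divide)
  with assms show ?thesis by auto
qed

text \<open>The hexagon contains the segments from (-\<open>sqrt 3\<close>/2, 0) to
  (\<open>sqrt 3\<close>/2, 0) and from (0, -1) to (0, 1). The point \<open>y\<close> is the
  midpoint of its two doubled coordinate projections, which lie on these segments. This bounds
  \<open>F0\<close> from above.\<close>

lemma small_in_hexagon:
  assumes "norm y \<le> 1/4"
  shows "y \<in> hexagon"
proof -
  have vert: "vector [0, 1] \<in> hexagon" "vector [0, -1] \<in> hexagon"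
      "vector [sqrt 3 / 2, 1 / 2] \<in> hexagon" "vector [- (sqrt 3 / 2), - (1 / 2)] \<in> hexagon"
      "vector [- (sqrt 3 / 2), 1 / 2] \<in> hexagon" "vector [sqrt 3 / 2, - (1 / 2)] \<in> hexagon"
    unfolding hexagon_def by (rule hull_inc, simp)+
  have comb: "u *\<^sub>R x + (1 - u) *\<^sub>R w \<in> hexagon"
    if "x \<in> hexagon" "w \<in> hexagon" "0 \<le> u" "u \<le> 1" for x w :: "real^2" and u
    using convexD[OF convex_hexagon that(1,2), of u "1 - u"] that by simp
  have le: "\<bar>y$1\<bar> \<le> 1/4" "\<bar>y$2\<bar> \<le> 1/4"
    using component_le_norm_cart[of y 1] component_le_norm_cart[of y 2] assms by linarith+
  have s3: "1 \<le> sqrt 3" by simp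
  have right: "vector [sqrt 3 / 2, 0] \<in> hexagon"
  proof -
    have "vector [sqrt 3 / 2, 0] =
      (1/2) *\<^sub>R (vector [sqrt 3 / 2, 1 / 2] :: real^2) + (1 - 1/2) *\<^sub>R vector [sqrt 3 / 2, - (1 / 2)]"
      by (simp add: vec_eq_iff forall_2)
    then show ?thesis using comb[OF vert(3,6), of "1/2"] by simp
  qed
  have left: "vector [- (sqrt 3 / 2), 0] \<in> hexagon"
  proof -
    have "vector [- (sqrt 3 / 2), 0] =
      (1/2) *\<^sub>R (vector [- (sqrt 3 / 2), 1 / 2] :: real^2) + (1 - 1/2) *\<^sub>R vector [- (sqrt 3 / 2), - (1 / 2)]"
      by (simp add: vec_eq_iff forall_2)
    then show ?thesis using comb[OF vert(5,4), of "1/2"] by simp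
  qed
  define u where "u = 1/2 + 2 * (y$1) / sqrt 3"
  have "\<bar>2 * (y$1)\<bar> \<le> (1/2) * sqrt 3" using le s3 by linarith
  then have u: "0 \<le> u" "u \<le> 1" unfolding u_def by (auto simp: abs_le_iff field_simps)
  have "u *\<^sub>R vector [sqrt 3 / 2, 0] + (1 - u) *\<^sub>R vector [- (sqrt 3 / 2), 0] \<in> hexagon"
    using comb[OF right left u] .
  moreover have "u *\<^sub>R vector [sqrt 3 / 2, 0] + (1 - u) *\<^sub>R vector [- (sqrt 3 / 2), 0]
      = (vector [2 * y$1, 0] :: real^2)"
    by (simp add: vec_eq_iff forall_2 u_def field_simps)
  ultimately have h: "vector [2 * y$1, 0] \<in> hexagon" by simp
  define w where "w = 1/2 + y$2"
  have w: "0 \<le> w" "w \<le> 1" using le unfolding w_def by linarith+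
  have "w *\<^sub>R vector [0, 1] + (1 - w) *\<^sub>R vector [0, -1] \<in> hexagon"
    using comb[OF vert(1,2) w] .
  moreover have "w *\<^sub>R vector [0, 1] + (1 - w) *\<^sub>R vector [0, -1]
      = (vector [0, 2 * y$2] :: real^2)"
    by (simp add: vec_eq_iff forall_2 w_def field_simps)
  ultimately have k: "vector [0, 2 * y$2] \<in> hexagon" by simp
  have "y = (1/2) *\<^sub>R vector [2 * y$1, 0] + (1 - 1/2) *\<^sub>R vector [0, 2 * y$2]"
    by (simp add: vec_eq_iff forall_2)
  with comb[OF h k, of "1/2"] show ?thesis by simp
qed

lemma F0_le:
  assumes "t > 0" "z \<in> hexagon"
  shows "F0 (t *\<^sub>R z) \<le> t"
  unfolding F0_def by (rule cInf_lower) (use assms in \<open>auto intro!: bdd_belowI[of _ 0]\<close>)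

lemma gauge_nonempty: "{t. t > 0 \<and> y \<in> (\<lambda>z. t *\<^sub>R z) ` hexagon} \<noteq> {}"
proof -
  define t where "t = 4 * norm y + 1"
  have t: "t > 0" unfolding t_def by (simp add: add_nonneg_pos)
  have "norm ((1/t) *\<^sub>R y) \<le> 1/4" using t by (simp add: divide_le_eq) (simp add: t_def)
  from small_in_hexagon[OF this] have "y \<in> (\<lambda>z. t *\<^sub>R z) ` hexagon"
    using t by (intro image_eqI[where x="(1/t) *\<^sub>R y"]) auto
  with t show ?thesis by auto
qed

lemma norm_le_F0: "norm y \<le> F0 y"
  unfolding F0_def
proof (rule cInf_greatest[OF gauge_nonempty])
  fix t assume "t \<in> {t. t > 0 \<and> y \<in> (\<lambda>z. t *\<^sub>R z) ` hexagon}"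
  then obtain z where "t > 0" "z \<in> hexagon" "y = t *\<^sub>R z" by auto
  then show "norm y \<le> t" using norm_hexagon_le[of z] by simp
qed

lemma F0_le_norm: "F0 y \<le> 4 * norm y"
proof (rule field_le_epsilon)
  fix e :: real assume e: "e > 0"
  \<comment> \<open>The slack \<open>e\<close> keeps the scaling factor positive even for
    \<open>y = 0\<close>.\<close>
  define t where "t = 4 * norm y + e"
  have t: "t > 0" unfolding t_def using e by (simp add: add_nonneg_pos)
  have "norm ((1/t) *\<^sub>R y) \<le> 1/4" using t e by (simp add: divide_le_eq) (simp add: t_def)
  from F0_le[OF t small_in_hexagon[OF this]] show "F0 y \<le> 4 * norm y + e"
    using t by (simp add: t_def)
qed

text \<open>If \<open>x = s z\<close> and \<open>y = t w\<close>, then \<open>x + y\<close> is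
  \<open>s + t\<close> times a convex combination of \<open>z\<close> and \<open>w\<close>. Together
  with the linear upper bound this makes \<open>F0\<close> Lipschitz, hence the length integrand
  piecewise continuous up to finitely many points.\<close>

lemma F0_triangle: "F0 (x + y) \<le> F0 x + F0 y"
proof (rule field_le_epsilon)
  fix e :: real assume e: "e > 0"
  have approx: "\<exists>t z. t > 0 \<and> z \<in> hexagon \<and> w = t *\<^sub>R z \<and> t < F0 w + e/2" for w
    using cInf_lessD[OF gauge_nonempty[of w], of "F0 w + e/2"] e unfolding F0_def by auto
  obtain s z where s: "s > 0" "z \<in> hexagon" "x = s *\<^sub>R z" "s < F0 x + e/2" 
    using approx[of x] by auto
  obtain t w where t: "t > 0" "w \<in> hexagon" "y = t *\<^sub>R w" "t < F0 y + e/2" 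
    using approx[of y] by auto
  have "(s/(s+t)) *\<^sub>R z + (t/(s+t)) *\<^sub>R w \<in> hexagon"
    using s t by (intro convexD[OF convex_hexagon]) (auto simp: add_divide_distrib[symmetric])
  from F0_le[OF _ this, of "s+t"] have "F0 (x + y) \<le> s + t"
    using s t by (simp add: scaleR_add_right)
  with s t show "F0 (x + y) \<le> F0 x + F0 y + e" by linarith
qed

lemma continuous_F0: "continuous_on UNIV F0"
proof -
  have "4-lipschitz_on UNIV F0"
  proof (rule lipschitz_onI)
    fix x y :: "real^2"
    have "F0 x \<le> F0 y + 4 * norm (x - y)" "F0 y \<le> F0 x + 4 * norm (x - y)"
      using F0_triangle[of y "x - y"] F0_triangle[of x "y - x"] F0_le_norm[of "x - y"]
        F0_le_norm[of "y - x"] by (auto simp: norm_minus_commute)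
    then show "dist (F0 x) (F0 y) \<le> 4 * dist x y"
      by (simp add: dist_norm abs_le_iff)
  qed simp
  then show ?thesis by (rule lipschitz_on_continuous_on)
qed

section \<open>The Finsler distance dominates the Euclidean distance\<close>

lemma integrable_on_finite_breaks:
  fixes g :: "real \<Rightarrow> real"
  assumes "finite B" "a \<le> b"
    and "\<And>r s. \<lbrakk>a \<le> r; r < s; s \<le> b; {r<..<s} \<inter> B = {}\<rbrakk> \<Longrightarrow> g integrable_on {r..s}"
  shows "g integrable_on {a..b}"
  using assms
proof (induction B arbitrary: a b rule: finite_induct)
  case empty
  then show ?case
    using empty.prems(2)[of a b] integrable_on_refl[of g b] by (cases "a = b") force+
next
  case (insert x B)
  show ?case
  proof (cases "x \<in> {a<..<b}")
    case True
    have "g integrable_on {a..x}"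
      by (rule insert.IH, use True in simp, rule insert.prems(2)) (use True in auto)
    moreover have "g integrable_on {x..b}"
      by (rule insert.IH, use True in simp, rule insert.prems(2)) (use True in auto)
    ultimately show ?thesis
      using True by (intro Henstock_Kurzweil_Integration.integrable_combine[of a x b]) auto
  next
    case False
    show ?thesis
      by (rule insert.IH[OF insert.prems(1)], rule insert.prems(2)) (use False in auto)
  qed
qed

text \<open>Guarantees that the infimum defining \<open>finsler_dist\<close> is taken over a
  nonempty set.\<close>

lemma piecewise_smooth_linepath: "piecewise_smooth (linepath p q) 0 1"
proof -
  define D where "D = (\<lambda>n::nat. if n = 0 then linepath p q else if n = 1 then (\<lambda>_. q - p) else (\<lambda>_. 0))"
  have "(D n has_vector_derivative D (Suc n) t) (at t within S)" for n t S
    unfolding D_def by (auto intro: has_vector_derivative_linepath_within)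
  then have "smooth_on_interval (linepath p q) r s" for r s
    unfolding smooth_on_interval_def by (intro exI[of _ D]) (auto simp: D_def)
  then show ?thesis unfolding piecewise_smooth_def by (auto intro!: exI[of _ "{}"])
qed

text \<open>The displacement is the integral of the velocity, whose norm is at most the integrand
  because \<open>norm y\<close> \<le> \<open>F0 y\<close> and \<open>f\<close> exceeds 1.
  Integrability must be shown, since \<open>integral\<close> is 0 on non-integrable
  functions.\<close>

lemma norm_le_finsler_length:
  assumes le: "t0 \<le> s0" and ps: "piecewise_smooth \<gamma> t0 s0"
    and f: "continuous_on UNIV f" and f1: "\<And>x. 1 < f x"
  shows "norm (\<gamma> s0 - \<gamma> t0) \<le> finsler_length f \<gamma> t0 s0"
proof -
  from ps obtain B where cont: "continuous_on {t0..s0} \<gamma>" and B: "finite B"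
    and sm: "\<And>r s. \<lbrakk>t0 \<le> r; r < s; s \<le> s0; {r<..<s} \<inter> B = {}\<rbrakk> \<Longrightarrow> smooth_on_interval \<gamma> r s"
    unfolding piecewise_smooth_def by blast
  have piece: "\<exists>D. continuous_on {r..s} D \<and> (\<forall>t\<in>{r<..<s}. (\<gamma> has_vector_derivative D t) (at t))"
    if rs: "t0 \<le> r" "r < s" "s \<le> s0" "{r<..<s} \<inter> B = {}" for r s
  proof -
    obtain D where D0: "\<And>t. t \<in> {r..s} \<Longrightarrow> D (0::nat) t = \<gamma> t" 
      and D: "\<And>n t. t\<in>{r..s} \<Longrightarrow> (D n has_vector_derivative D (Suc n) t) (at t within {r..s})"
      using sm[OF rs] unfolding smooth_on_interval_def by blast
    have "continuous_on {r..s} (D 1)"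
      by (rule continuous_on_vector_derivative[of _ _ "D 2"]) (use D[of _ 1] in \<open>simp add: numeral_2_eq_2\<close>)
    moreover have "(\<gamma> has_vector_derivative D 1 t) (at t)" if t: "t \<in> {r<..<s}" for t
    proof -
      have "(D 0 has_vector_derivative D 1 t) (at t)"
        using D[of t 0] t by (simp add: at_within_Icc_at)
      then show ?thesis
        by (rule has_vector_derivative_transform_within_open[where S="{r<..<s}"])
          (use t D0 in auto)
    qed
    ultimately show ?thesis by blast
  qed
  let ?g = "\<lambda>t. Fhat f (\<gamma> t) (vector_derivative \<gamma> (at t))"
  have g: "?g integrable_on {t0..s0}"
  proof (rule integrable_on_finite_breaks[OF B le])
    fix r s assume rs: "t0 \<le> r" "r < s" "s \<le> s0" "{r<..<s} \<inter> B = {}"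
    from piece[OF this] obtain D where D: "continuous_on {r..s} D" 
      "\<And>t. t\<in>{r<..<s} \<Longrightarrow> (\<gamma> has_vector_derivative D t) (at t)" by blast
    have "continuous_on {r..s} \<gamma>"
      using cont rs by (auto intro: continuous_on_subset)
    then have "continuous_on {r..s} (\<lambda>t. f (\<gamma> t) * F0 (D t))"
      using D(1) continuous_on_compose2[OF f, of _ \<gamma>] continuous_on_compose2[OF continuous_F0, of _ D]
      by (intro continuous_on_mult) auto
    then have "(\<lambda>t. f (\<gamma> t) * F0 (D t)) integrable_on {r..s}"
      by (rule integrable_continuous_real)
    \<comment> \<open>The two-sided derivative is known to equal \<open>D t\<close> only inside the
      interval; the two end points do not affect integrability.\<close>
    then show "?g integrable_on {r..s}"
      by (rule integrable_spike_finite[of "{r, s}", rotated 2])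
        (auto simp: Fhat_def vector_derivative_at[OF D(2)])
  qed
  have "(\<gamma> has_vector_derivative vector_derivative \<gamma> (at t)) (at t)"
    if t: "t \<in> {t0<..<s0} - B" for t
  proof -
    \<comment> \<open>Away from the finitely many break points there is a small interval around
      \<open>t\<close> free of them, on which \<open>piece\<close> applies.\<close>
    have "open ({t0<..<s0} - B)" using B by (simp add: finite_imp_closed open_Diff)
    from openE[OF this t] obtain e where e: "e > 0" "ball t e \<subseteq> {t0<..<s0} - B" by blast
    then have sub: "{t - e/2..t + e/2} \<subseteq> {t0<..<s0} - B"
      by (intro order.trans[OF _ e(2)]) (auto simp: dist_real_def)
    have "t - e/2 \<in> {t0<..<s0} - B" "t + e/2 \<in> {t0<..<s0} - B"
      by (rule subsetD[OF sub], use e(1) in simp)+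
    then have "t0 \<le> t - e/2" "t + e/2 \<le> s0" by auto
    moreover have "{t - e/2<..<t + e/2} \<inter> B = {}"
      using sub greaterThanLessThan_subseteq_atLeastAtMost_iff[of "t - e/2" "t + e/2"] by blast
    ultimately obtain D where "(\<gamma> has_vector_derivative D) (at t)"
      using piece[of "t - e/2" "t + e/2"] e(1) by force
    then show ?thesis by (simp add: vector_derivative_at)
  qed
  then have "((\<lambda>t. vector_derivative \<gamma> (at t)) has_integral (\<gamma> s0 - \<gamma> t0)) {t0..s0}"
    by (intro fundamental_theorem_of_calculus_interior_strong[OF B le _ cont]) auto
  then have hi: "(\<lambda>t. vector_derivative \<gamma> (at t)) integrable_on {t0..s0}"
    "integral {t0..s0} (\<lambda>t. vector_derivative \<gamma> (at t)) = \<gamma> s0 - \<gamma> t0"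
    by (auto simp: has_integral_integrable_integral)
  have "norm y \<le> Fhat f x y" for x y
    using mult_mono[OF less_imp_le[OF f1[of x]] norm_le_F0[of y]] f1[of x]
    by (simp add: Fhat_def)
  then have "norm (integral {t0..s0} (\<lambda>t. vector_derivative \<gamma> (at t))) \<le> integral {t0..s0} ?g"
    by (intro integral_norm_bound_integral hi g)
  then show ?thesis by (simp add: hi finsler_length_def)
qed

lemma norm_le_finsler_dist:
  assumes "continuous_on UNIV f" "\<And>x. 1 < f x"
  shows "norm (q - p) \<le> finsler_dist f p q"
  unfolding finsler_dist_def
proof (rule cInf_greatest)
  have "piecewise_smooth (linepath p q) 0 1 \<and> linepath p q 0 = p \<and> linepath p q 1 = q"
    by (simp add: piecewise_smooth_linepath linepath_0' linepath_1')
  then show "{finsler_length f \<gamma> t0 s0 | \<gamma> t0 s0.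
       t0 \<le> s0 \<and> piecewise_smooth \<gamma> t0 s0 \<and> \<gamma> t0 = p \<and> \<gamma> s0 = q} \<noteq> {}"
    using zero_le_one by blast
qed (use norm_le_finsler_length[OF _ _ assms] in blast)

lemma finsler_bounded_imp_bounded:
  assumes "continuous_on UNIV f" "\<And>x. 1 < f x" "finsler_bounded f U"
  shows "bounded U"
proof -
  from assms(3) obtain p C where C: "\<And>q. q \<in> U \<Longrightarrow> finsler_dist f p q \<le> C"
    unfolding finsler_bounded_def by blast
  have "norm (q - p) \<le> C" if "q \<in> U" for q
    using order.trans[OF norm_le_finsler_dist[OF assms(1,2)] C[OF that]] .
  then have "U \<subseteq> cball p C"
    by (auto simp: dist_norm norm_minus_commute)
  then show ?thesis by (rule bounded_subset[OF bounded_cball])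
qed

section \<open>Minimal paths\<close>

lemma v_eqI:
  assumes "pi * real i / 6 = \<phi>" "sin \<phi> = x" "cos \<phi> = y"
  shows "v i = vector [x, y]"
  using assms by (simp add: v_def clock_dir_def)

lemma v_even:
  "v 0 = vector [0, 1]" "v 2 = vector [sqrt 3 / 2, 1/2]" "v 4 = vector [sqrt 3 / 2, - 1/2]"
  "v 6 = vector [0, -1]" "v 8 = vector [- sqrt 3 / 2, - 1/2]"
  "v 10 = vector [- sqrt 3 / 2, 1/2]" "v 12 = vector [0, 1]"
  by (rule v_eqI[of 0 0] v_eqI[of 2 "pi / 3"] v_eqI[of 4 "pi - pi / 3"] v_eqI[of 6 "pi"]
      v_eqI[of 8 "pi / 3 + pi"] v_eqI[of 10 "2 * pi - pi / 3"] v_eqI[of 12 "2 * pi"];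
    (simp only: sin_add sin_diff cos_add cos_diff)?; simp add: sin_60 cos_60)+

text \<open>Indices beyond 12 are kept unreduced so that the normals \<open>v (i + 9)\<close> and
  \<open>v (i + 11)\<close> for \<open>i\<close> = 0, 2, 4 form the chain 9, 11, 13, 15.\<close>

lemma v_normal:
  "v 9 = vector [-1, 0]" "v 11 = vector [- 1/2, sqrt 3 / 2]"
  "v 13 = vector [1/2, sqrt 3 / 2]" "v 15 = vector [1, 0]"
  by (rule v_eqI[of 9 "pi / 2 + pi"] v_eqI[of 11 "2 * pi - pi / 6"]
      v_eqI[of 13 "pi / 6 + 2 * pi"] v_eqI[of 15 "pi / 2 + 2 * pi"];
    (simp only: sin_add sin_diff cos_add cos_diff)?; simp add: sin_30 cos_30)+

lemmas v_simps = v_even v_even(2)[unfolded numeral_2_eq_2] v_normal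

text \<open>Scaling the second coordinate by \<open>sqrt 3\<close> turns the three boundary lines
  into \<open>X = 0\<close>, \<open>Y = X\<close> and \<open>Y = -X\<close>, so the disjointness of
  the sectors can be read off from signs.\<close>

lemma sector_signs:
  fixes p q :: "real^2"
  defines "X \<equiv> q$1 - p$1" and "Y \<equiv> sqrt 3 * (q$2 - p$2)"
  shows "q \<in> sector 1 p \<Longrightarrow> X > 0 \<and> Y > X" "q \<in> sector 3 p \<Longrightarrow> Y < X \<and> Y > - X"
    "q \<in> sector 5 p \<Longrightarrow> X > 0 \<and> Y < - X" "q \<in> sector 7 p \<Longrightarrow> X < 0 \<and> Y < X"
    "q \<in> sector 9 p \<Longrightarrow> Y > X \<and> Y < - X" "q \<in> sector 11 p \<Longrightarrow> X < 0 \<and> Y > - X"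
  by (auto simp: sector_def v_simps X_def Y_def algebra_simps)

lemma sector_table_unique:
  assumes "(k, i, j) \<in> sector_table" "(k', i', j') \<in> sector_table"
    and "q \<in> sector k p" "q \<in> sector k' p"
  shows "(k', i', j') = (k, i, j)"
  using assms(1,2)[unfolded sector_table_def] assms(3,4)
  by (elim insertE emptyE) (auto simp del: One_nat_def dest!: sector_signs)

text \<open>The sector containing \<open>q\<close> is unique, and the independent directions
  \<open>v i\<close> and \<open>v (i + 2)\<close> make the two lines meet in one point.\<close>

lemma corner_eq:
  assumes "i \<in> {0, 2, 4}" "s > 0" "t > 0" and q: "q = p + s *\<^sub>R v i + t *\<^sub>R v (i + 2)"
  shows "corner p q = p + s *\<^sub>R v i"
  unfolding corner_def
proof (rule the_equality)
  have tab: "(i + 1, i, i + 2) \<in> sector_table"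
    using assms(1) by (auto simp: sector_table_def)
  have sec: "q \<in> sector (i + 1) p"
    using assms by (auto simp: sector_def)
  have "p + s *\<^sub>R v i \<in> dir_line i p \<inter> dir_line (i + 2) q"
    using q by (auto simp: dir_line_def intro!: exI[of _ "- t"])
  with tab sec show "\<exists>(k, i', j) \<in> sector_table.
      q \<in> sector k p \<and> p + s *\<^sub>R v i \<in> dir_line i' p \<inter> dir_line j q"
    by blast
  fix a assume "\<exists>(k, i, j) \<in> sector_table. q \<in> sector k p \<and> a \<in> dir_line i p \<inter> dir_line j q"
  then obtain k' i' j' where k': "(k', i', j') \<in> sector_table" "q \<in> sector k' p"
    and a: "a \<in> dir_line i' p \<inter> dir_line j' q" by blast
  with sector_table_unique[OF tab k'(1) sec k'(2)] have "a \<in> dir_line i p \<inter> dir_line (i + 2) q"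
    by simp
  then obtain s' t' where st: "a = p + s' *\<^sub>R v i" "a = q + t' *\<^sub>R v (i + 2)"
    unfolding dir_line_def by blast
  then have "(s' - s) *\<^sub>R v i = (t + t') *\<^sub>R v (i + 2)"
    using q by (simp add: algebra_simps)
  then have "s' = s"
    using assms(1) by (auto simp: v_simps vec_eq_iff forall_2)
  with st show "a = p + s *\<^sub>R v i" by simp
qed

lemma strongly_convex_midpoint:
  assumes U: "strongly_convex U" and "p \<in> closure U" "q \<in> closure U"
    and "i \<in> {0, 2, 4, 6, 8, 10}" "s > 0" and q: "q = p + s *\<^sub>R v i"
  shows "p + (s/2) *\<^sub>R v i \<in> U"
proof -
  have vn: "v i \<noteq> 0" using assms(4) by (auto simp: v_simps vec_eq_iff forall_2)
  have "min_path p q = linepath p q"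
    using assms vn unfolding min_path_def pos_multiple_def by auto
  moreover have "p + (s/2) *\<^sub>R v i = linepath p q (1/2)"
    by (simp add: linepath_def q vec_eq_iff algebra_simps)
  ultimately have "p + (s/2) *\<^sub>R v i \<in> path_image (min_path p q)"
    unfolding path_image_def by (metis atLeastAtMost_iff image_eqI
        divide_le_eq_1_pos one_le_numeral zero_le_divide_1_iff zero_le_numeral zero_less_numeral)
  moreover have "p + (s/2) *\<^sub>R v i \<notin> {p, q}" using q vn \<open>s > 0\<close> by auto
  ultimately show ?thesis using U assms(2,3) unfolding strongly_convex_def by blast
qed

lemma strongly_convex_corner:
  assumes U: "strongly_convex U" and "p \<in> closure U" "q \<in> closure U"
    and i: "i \<in> {0, 2, 4}" and "s > 0" "t > 0" and q: "q = p + s *\<^sub>R v i + t *\<^sub>R v (i + 2)"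
  shows "p + s *\<^sub>R v i \<in> U"
proof -
  have vn: "v i \<noteq> 0" "v (i + 2) \<noteq> 0" using i by (auto simp: v_simps vec_eq_iff forall_2)
  have "q \<in> sector (i + 1) p" using assms by (auto simp: sector_def)
  \<comment> \<open>An open sector contains no point of a boundary half-line, so the straight branch
    of \<open>min_path\<close> is excluded.\<close>
  then have "\<not> pos_multiple (q - p) (v j)" if "j \<in> {0, 2, 4, 6, 8, 10}" for j
    using i that sector_signs[where p=p and q=q]
    by (auto simp: pos_multiple_def v_simps vec_eq_iff forall_2 algebra_simps mult_less_0_iff)
  moreover have "p \<noteq> q"
    using i \<open>q \<in> sector (i + 1) p\<close> sector_signs[where p=p and q=q] by auto
  ultimately have "min_path p q = linepath p (p + s *\<^sub>R v i) +++ linepath (p + s *\<^sub>R v i) q"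
    unfolding min_path_def corner_eq[OF i \<open>s > 0\<close> \<open>t > 0\<close> q] by auto
  then have "p + s *\<^sub>R v i \<in> path_image (min_path p q)"
    by (simp add: path_image_join)
  moreover have "p + s *\<^sub>R v i \<notin> {p, q}" using q vn \<open>s > 0\<close> \<open>t > 0\<close> by auto
  ultimately show ?thesis using U assms(2,3) unfolding strongly_convex_def by blast
qed

section \<open>Support lines\<close>

definition maximiser :: "'a::real_inner set \<Rightarrow> 'a \<Rightarrow> 'a \<Rightarrow> bool" where
  "maximiser U n p \<longleftrightarrow> p \<in> closure U \<and> (\<forall>x\<in>closure U. inner n x \<le> inner n p)"

lemma maximiser_exists:
  fixes U :: "'a::euclidean_space set"
  assumes "bounded U" "U \<noteq> {}"
  shows "\<exists>p. maximiser U n p"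
proof -
  have "\<exists>p\<in>closure U. \<forall>x\<in>closure U. inner n x \<le> inner n p"
    using assms by (intro continuous_attains_sup continuous_intros) auto
  then show ?thesis by (auto simp: maximiser_def)
qed

text \<open>From a point of an open set one can move a little along \<open>n\<close> without leaving
  the set, which increases the functional. So \<open>U\<close> misses its support lines.\<close>

lemma inner_less_maximiser:
  assumes "open U" "u \<in> U" "n \<noteq> 0" "maximiser U n p"
  shows "inner n u < inner n p"
proof -
  obtain e where e: "e > 0" "cball u e \<subseteq> U"
    using assms open_contains_cball by blast
  define w where "w = u + (e / norm n) *\<^sub>R n"
  have "w \<in> cball u e"
    using e \<open>n \<noteq> 0\<close> by (simp add: w_def dist_norm)
  then have "w \<in> closure U" using e closure_subset by blast
  then have "inner n w \<le> inner n p" using assms unfolding maximiser_def by blast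
  moreover have "inner n w > inner n u" using e \<open>n \<noteq> 0\<close> by (simp add: w_def inner_add_right)
  ultimately show ?thesis by linarith
qed

text \<open>Dual basis: \<open>v (i + 11)\<close> is orthogonal to \<open>v (i + 2)\<close> and
  \<open>v (i + 9)\<close> to \<open>v i\<close>; the remaining inner products are
  \<open>sqrt 3 / 2\<close> and \<open>- sqrt 3 / 2\<close>.\<close>

lemma sector_coordinates:
  assumes "i \<in> {0, 2, 4}"
  shows "z = (2 / sqrt 3 * inner (v (i + 11)) z) *\<^sub>R v i 
    + (- 2 / sqrt 3 * inner (v (i + 9)) z) *\<^sub>R v (i + 2)"
  using assms 
  by (auto simp: v_simps vec_eq_iff forall_2 inner_vec_def sum_2 field_simps)

lemma adjacent_maximisers_eq:
  assumes U: "open U" "strongly_convex U" and i: "i \<in> {0, 2, 4}"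
    and p: "maximiser U (v (i + 9)) p" and q: "maximiser U (v (i + 11)) q"
  shows "p = q"
proof -
  define s where "s = 2 / sqrt 3 * inner (v (i + 11)) (q - p)"
  define t where "t = - 2 / sqrt 3 * inner (v (i + 9)) (q - p)"
  have q_eq: "q = p + s *\<^sub>R v i + t *\<^sub>R v (i + 2)"
    using sector_coordinates[OF i, of "q - p"] unfolding s_def t_def by (simp add: algebra_simps)
  have pq: "p \<in> closure U" "q \<in> closure U" using p q by (auto simp: maximiser_def)
  \<comment> \<open>Up to positive factors, \<open>s\<close> and \<open>t\<close> are the gains of
    the two functionals at their own maximisers over the other point.\<close>
  have "s \<ge> 0" using q pq by (simp add: s_def maximiser_def inner_diff_right)
  have "t \<ge> 0" using p pq by (simp add: t_def maximiser_def inner_diff_right divide_le_0_iff)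
  have orth: "inner (v (i + 9)) (v i) = 0" "inner (v (i + 11)) (v (i + 2)) = 0"
    and nz: "v (i + 9) \<noteq> 0" "v (i + 11) \<noteq> 0"
    using i by (auto simp: v_simps inner_vec_def sum_2 vec_eq_iff forall_2)
  have no_p: "p + r *\<^sub>R v i \<notin> U" for r
    using inner_less_maximiser[OF U(1) _ nz(1) p, of "p + r *\<^sub>R v i"] orth
    by (auto simp: inner_add_right)
  have no_q: "q + r *\<^sub>R v (i + 2) \<notin> U" for r
    using inner_less_maximiser[OF U(1) _ nz(2) q, of "q + r *\<^sub>R v (i + 2)"] orth
    by (auto simp: inner_add_right)
  consider "s > 0" "t > 0" | "s > 0" "t = 0" | "s = 0" "t > 0" | "s = 0" "t = 0"
    using \<open>s \<ge> 0\<close> \<open>t \<ge> 0\<close> by linarith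
  then show ?thesis
  proof cases
    case 1
    with strongly_convex_corner[OF U(2) pq i _ _ q_eq] no_p show ?thesis by blast
  next
    case 2
    with strongly_convex_midpoint[OF U(2) pq, of i s] q_eq i no_p show ?thesis by auto
  next
    case 3
    then have "p + (t/2) *\<^sub>R v (i + 2) \<in> U"
      using i q_eq by (intro strongly_convex_midpoint[OF U(2) pq]) auto
    \<comment> \<open>Now \<open>p\<close> lies on the support line through \<open>q\<close>, so the
      midpoint is rewritten from \<open>q\<close> to contradict \<open>no_q\<close>.\<close>
    moreover have "p + (t/2) *\<^sub>R v (i + 2) = q + (- t/2) *\<^sub>R v (i + 2)"
      using 3 q_eq by (simp add: vec_eq_iff algebra_simps)
    ultimately show ?thesis using no_q by metis
  qed (use q_eq in simp)
qed

lemma no_bounded_strongly_convex: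
  assumes "open U" "strongly_convex U" "bounded U"
  shows "U = {}"
proof (rule ccontr)
  assume "U \<noteq> {}"
  then obtain u where u: "u \<in> U" by blast
  note ex = maximiser_exists[OF assms(3) \<open>U \<noteq> {}\<close>]
  obtain p9 where p9: "maximiser U (v 9) p9" using ex by blast
  obtain p11 where p11: "maximiser U (v 11) p11" using ex by blast
  obtain p13 where p13: "maximiser U (v 13) p13" using ex by blast
  obtain p15 where p15: "maximiser U (v 15) p15" using ex by blast
  have "p9 = p11" "p11 = p13" "p13 = p15"
    using adjacent_maximisers_eq[OF assms(1,2), of 0 p9 p11]
      adjacent_maximisers_eq[OF assms(1,2), of 2 p11 p13]
      adjacent_maximisers_eq[OF assms(1,2), of 4 p13 p15] p9 p11 p13 p15 by simp_all
  \<comment> \<open>With opposite normals at one common point, the two strict inequalities for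
    \<open>u\<close> contradict each other.\<close>
  moreover have v9: "v 9 = - v 15" "v 15 \<noteq> 0" by (auto simp: v_simps vec_eq_iff forall_2)
  ultimately show False
    using inner_less_maximiser[OF assms(1) u _ p9] inner_less_maximiser[OF assms(1) u _ p15]
    by (simp add: inner_minus_left)
qed

theorem theorem8p6:
  fixes \<theta> :: real and a b c d :: "real^2" and f :: "real^2 \<Rightarrow> real"
  assumes theta: "pi / 3 < \<theta>" "\<theta> \<le> pi / 2"
    and trapezoid: "is_trapezoid \<theta> a b c d"
    and f_cont: "continuous_on UNIV f"
    and f_pos: "\<And>x. 0 < f x"
    and f_decr: "\<And>p q. q \<in> up_cone \<theta> p \<Longrightarrow> f q < f p"
    and f_range: "\<And>x. f x \<in> {1<..<trapezoid_ratio a b c d}"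
  shows "\<not> (\<exists>U. U \<noteq> {} \<and> finsler_bounded f U \<and> open U \<and> strongly_convex U)"
proof -
  have "1 < f x" for x using f_range[of x] by simp
  then show ?thesis
    using finsler_bounded_imp_bounded[OF f_cont] no_bounded_strongly_convex by blast
qed

end
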